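(* Let $X,Y$ be Banach spaces and let $I:X\to\mathbb{R}$ and $R:X\to Y$ be Fréchet differentiable. Suppose that $0$ is a regular value of $R$, set $S:=R^{-1}(0)$, and let $A\subset S$ be a subset of critical points of $I|_S$. Suppose that for all $u,v\in A$ there exists $\gamma:[0,1]\to S$ such that (a) $\gamma(0)=u$ and $\gamma(1)=v$; (b) $\gamma$ is locally Lipschitz at $t=0$, that is, there are $\delta>0$ and $C$ such that $\|\gamma(t)-u\|_X\le Ct$ for each $t\in[0,\delta]$; (c) $t\mapsto I(\gamma(t))$ is convex in $[0,1]$. Then (i) $I|_S$ is constant on $A$; (ii) $t\mapsto I|_S(\gamma(t))$ is a constant function (for each such $\gamma$); (iii) if condition (c) holds with strict convexity for all $u\ne v$, then $A$ has at most one element.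
   Context: A point $u\in S$ is a critical point of $I|_S$ if and only if there exists $\lambda$ (depending on $u$) in the dual space $Y^*$ of $Y$ such that $u$ is a critical point of the functional $J=I-\lambda\circ R:X\to\mathbb{R}$, i.e. $I'(u)=\lambda\circ R'(u)$. *)

theory Defs
  imports "HOL-Analysis.Analysis"
begin

definition regular_value :: "('a::real_normed_vector \<Rightarrow> 'b::real_normed_vector) \<Rightarrow> 'b \<Rightarrow> bool"
  where "regular_value R y \<longleftrightarrow>
    (\<forall>u. R u = y \<longrightarrow> R differentiable (at u) \<and> surj (frechet_derivative R (at u)))"

definition critical_point :: "('a::real_normed_vector \<Rightarrow> real) \<Rightarrow> 'a \<Rightarrow> bool"
  where "critical_point J u \<longleftrightarrow> (J has_derivative (\<lambda>_. 0)) (at u)"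

(* Critical points of the restriction of I to S = R -` {0}, in Lagrange multiplier form. The
   multiplier may depend on u, and the blinfun type makes it an element of the dual space. *)
definition constrained_critical_point ::
    "('a::real_normed_vector \<Rightarrow> real) \<Rightarrow> ('a \<Rightarrow> 'b::real_normed_vector) \<Rightarrow> 'a \<Rightarrow> bool"
  where "constrained_critical_point I R u \<longleftrightarrow>
    u \<in> R -` {0} \<and>
    (\<exists>l :: 'b \<Rightarrow>\<^sub>L real. critical_point (\<lambda>x. I x - blinfun_apply l (R x)) u)"

definition strictly_convex_on :: "'a::real_vector set \<Rightarrow> ('a \<Rightarrow> real) \<Rightarrow> bool"
  where "strictly_convex_on S f \<longleftrightarrow> convex S \<and>
    (\<forall>x\<in>S. \<forall>y\<in>S. x \<noteq> y \<longrightarrow>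
      (\<forall>a>0. \<forall>b>0. a + b = 1 \<longrightarrow> f (a *\<^sub>R x + b *\<^sub>R y) < a * f x + b * f y))"

(* A map g from [0,1] to S joining u to v that is Lipschitz at its starting point; no continuity
   is required. Only values on [0,1] matter, hence the intersection with {0..1}. *)
definition joins_in :: "'a::real_normed_vector set \<Rightarrow> 'a \<Rightarrow> 'a \<Rightarrow> (real \<Rightarrow> 'a) \<Rightarrow> bool"
  where "joins_in S u v g \<longleftrightarrow>
    g ` {0..1} \<subseteq> S \<and> g 0 = u \<and> g 1 = v \<and>
    (\<exists>\<delta>>0. \<exists>C. \<forall>t\<in>{0..\<delta>} \<inter> {0..1}. norm (g t - u) \<le> C * t)"

end

theory Submission
  imports Defs
begin

text \<open>
  On \<open>S = R -` {0}\<close> the functionals \<open>I\<close> and \<open>J = I - \<lambda> \<circ> R\<close> agree. Since \<open>J\<close> has zero derivative at \<open>u\<close>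
  and \<open>\<gamma>\<close> is Lipschitz at \<open>0\<close>, \<open>I (\<gamma> t) - I u = o(t)\<close>, so the convex function \<open>I \<circ> \<gamma>\<close> attains its
  minimum at \<open>0\<close>. In particular \<open>I u \<le> I v\<close>, and exchanging \<open>u\<close> and \<open>v\<close> gives equality; then
  convexity bounds \<open>I \<circ> \<gamma>\<close> from above by the same value.
\<close>

text \<open>By convexity, a value \<open>f s\<close> below \<open>f 0\<close> would force
  \<open>f\<close> to fall at a linear rate from 0 towards \<open>s\<close>. The hypothesis
  \<open>small\<close>, a one-sided form of nonnegative slope at 0, forbids this.\<close>

lemma convex_on_unit_interval_min_at_0:
  fixes f :: "real \<Rightarrow> real"
  assumes conv: "convex_on {0..1} f"
    and small: "\<And>\<epsilon>. 0 < \<epsilon> \<Longrightarrow> \<exists>\<delta>>0. \<forall>t\<in>{0..\<delta>} \<inter> {0..1}. f 0 - \<epsilon> * t \<le> f t"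
    and s: "s \<in> {0..1}"
  shows "f 0 \<le> f s"
proof (rule field_le_epsilon)
  fix \<epsilon> :: real assume "0 < \<epsilon>"
  then obtain \<delta> where \<delta>: "0 < \<delta>" "\<And>t. t \<in> {0..\<delta>} \<inter> {0..1} \<Longrightarrow> f 0 - \<epsilon> * t \<le> f t"
    using small by blast
  \<comment> \<open>\<open>t\<close> serves as the convex weight of \<open>s\<close> against 0,
    hence the bound by 1. The point \<open>t * s\<close> stays within \<delta> because
    \<open>s\<close> is at most 1.\<close>
  define t where "t = min \<delta> 1"
  have t: "0 < t" "t \<le> \<delta>" "t \<le> 1" using \<delta>(1) by (auto simp: t_def)
  have ts: "0 \<le> t * s" "t * s \<le> t"
    using s t mult_left_le[of s t] by auto
  have "f 0 - \<epsilon> * (t * s) \<le> f (t * s)"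
    using \<delta>(2)[of "t * s"] t ts by auto
  moreover have "f (t * s) \<le> (1 - t) * f 0 + t * f s"
    using convex_onD[OF conv, of t 0 s] s t by simp
  \<comment> \<open>Dropping \<open>s\<close> leaves \<open>t\<close> as a common factor of all
    terms, which is then cancelled.\<close>
  moreover have "\<epsilon> * (t * s) \<le> \<epsilon> * t"
    using ts \<open>0 < \<epsilon>\<close> by simp
  ultimately have "t * f 0 \<le> t * (f s + \<epsilon>)"
    by (simp add: algebra_simps)
  then show "f 0 \<le> f s + \<epsilon>"
    using t by simp
qed

lemma strictly_convex_onD:
  assumes "strictly_convex_on S f" "x \<in> S" "y \<in> S" "x \<noteq> y" "0 < a" "0 < b" "a + b = 1"
  shows "f (a *\<^sub>R x + b *\<^sub>R y) < a * f x + b * f y"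
  using assms unfolding strictly_convex_on_def by blast

lemma strictly_convex_on_imp_convex_on:
  assumes "strictly_convex_on S f"
  shows "convex_on S f"
proof (rule convex_onI)
  show "convex S" using assms by (simp add: strictly_convex_on_def)
  fix t :: real and x y assume *: "0 < t" "t < 1" "x \<in> S" "y \<in> S"
  show "f ((1 - t) *\<^sub>R x + t *\<^sub>R y) \<le> (1 - t) * f x + t * f y"
  proof (cases "x = y")
    case True
    then show ?thesis by (simp add: algebra_simps flip: scaleR_add_left)
  next
    case False
    then have "f ((1 - t) *\<^sub>R x + t *\<^sub>R y) < (1 - t) * f x + t * f y"
      using strictly_convex_onD[OF assms, of x y "1 - t" t] * by simp
    then show ?thesis by simp
  qed
qed

text \<open>This supplies the hypothesis \<open>small\<close> of
  \<open>convex_on_unit_interval_min_at_0\<close> for \<open>I\<close> along the path.\<close>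

lemma critical_point_lower_bound_along_path:
  fixes I :: "'x::real_normed_vector \<Rightarrow> real" and R :: "'x \<Rightarrow> 'y::real_normed_vector"
  assumes crit: "constrained_critical_point I R u"
    and path: "joins_in (R -` {0}) u v \<gamma>"
    and "0 < \<epsilon>"
  shows "\<exists>\<delta>>0. \<forall>t\<in>{0..\<delta>} \<inter> {0..1}. I u - \<epsilon> * t \<le> I (\<gamma> t)"
proof -
  obtain l :: "'y \<Rightarrow>\<^sub>L real"
    where l: "((\<lambda>x. I x - blinfun_apply l (R x)) has_derivative (\<lambda>_. 0)) (at u)"
    and Ru: "R u = 0"
    using crit unfolding constrained_critical_point_def critical_point_def by auto
  obtain \<delta> C where \<delta>: "0 < \<delta>"
    and C: "\<And>t. t \<in> {0..\<delta>} \<inter> {0..1} \<Longrightarrow> norm (\<gamma> t - u) \<le> C * t"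
    using path unfolding joins_in_def by blast
  have R\<gamma>: "R (\<gamma> t) = 0" if "t \<in> {0..1}" for t
    using path that unfolding joins_in_def by blast
  \<comment> \<open>\<open>C\<close> may be zero or negative; \<open>K\<close> is a positive
    Lipschitz constant by which one can divide.\<close>
  define K where "K = \<bar>C\<bar> + 1"
  have K: "0 < K" "C \<le> K" by (auto simp: K_def)
  \<comment> \<open>The tolerance \<epsilon> / \<open>K\<close> offsets the factor \<open>K\<close>
    that comes from the Lipschitz bound. The multiplier term at \<open>u\<close> vanishes as
    \<open>R u = 0\<close>.\<close>
  obtain d where d: "0 < d" and lin: "\<And>y. norm (y - u) < d \<Longrightarrow>
      \<bar>(I y - blinfun_apply l (R y)) - I u\<bar> \<le> \<epsilon> / K * norm (y - u)"
    using l Ru \<open>0 < \<epsilon>\<close> K unfolding has_derivative_at_alt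
    by (auto dest!: spec[of _ "\<epsilon> / K"] simp: blinfun.zero_right)
  \<comment> \<open>The factor 2 in \<open>d / (2 * K)\<close> gives the strict inequality that
    \<open>lin\<close> demands.\<close>
  have "I u - \<epsilon> * t \<le> I (\<gamma> t)" if t: "t \<in> {0..min \<delta> (d / (2 * K))} \<inter> {0..1}" for t
  proof -
    have "norm (\<gamma> t - u) \<le> C * t" using C t by auto
    also have "\<dots> \<le> K * t" using K t by (intro mult_right_mono) auto
    finally have Kt: "norm (\<gamma> t - u) \<le> K * t" .
    have "t \<le> d / (2 * K)" using t by simp
    then have "K * t \<le> d / 2" using K by (simp add: field_simps)
    then have "norm (\<gamma> t - u) < d" using Kt d by simp
    then have "\<bar>I (\<gamma> t) - I u\<bar> \<le> \<epsilon> / K * norm (\<gamma> t - u)"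
      using lin[of "\<gamma> t"] R\<gamma>[of t] t by (simp add: blinfun.zero_right)
    also have "\<dots> \<le> \<epsilon> / K * (K * t)"
      using Kt K \<open>0 < \<epsilon>\<close> by (intro mult_left_mono) auto
    also have "\<dots> = \<epsilon> * t" using K by simp
    finally show ?thesis by simp
  qed
  moreover have "0 < min \<delta> (d / (2 * K))" using \<delta> d K by simp
  ultimately show ?thesis by blast
qed

lemma critical_point_min_along_convex_path:
  fixes I :: "'x::real_normed_vector \<Rightarrow> real" and R :: "'x \<Rightarrow> 'y::real_normed_vector"
  assumes crit: "constrained_critical_point I R u"
    and path: "joins_in (R -` {0}) u v \<gamma>"
    and conv: "convex_on {0..1} (\<lambda>t. I (\<gamma> t))"
    and t: "t \<in> {0..1}"
  shows "I u \<le> I (\<gamma> t)"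
proof -
  have \<gamma>0: "\<gamma> 0 = u" using path by (simp add: joins_in_def)
  show ?thesis
    using convex_on_unit_interval_min_at_0[OF conv _ t]
      critical_point_lower_bound_along_path[OF crit path]
    by (simp add: \<gamma>0)
qed

theorem corollary1p2:
  fixes I :: "'x::banach \<Rightarrow> real"
    and R :: "'x \<Rightarrow> 'y::banach"
    and S A :: "'x set"
  assumes "\<And>x. I differentiable (at x)"
    and "\<And>x. R differentiable (at x)"
    and "regular_value R 0"
    and "S = R -` {0}"
    and "A \<subseteq> S"
    and "\<And>u. u \<in> A \<Longrightarrow> constrained_critical_point I R u"
    and "\<And>u v. u \<in> A \<Longrightarrow> v \<in> A \<Longrightarrow>
      \<exists>\<gamma>. joins_in S u v \<gamma> \<and> convex_on {0..1} (\<lambda>t. I (\<gamma> t))"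
  shows "I constant_on A
    \<and> (\<forall>u\<in>A. \<forall>v\<in>A. \<forall>\<gamma>. joins_in S u v \<gamma> \<and> convex_on {0..1} (\<lambda>t. I (\<gamma> t))
         \<longrightarrow> (\<lambda>t. I (\<gamma> t)) constant_on {0..1})
    \<and> ((\<forall>u\<in>A. \<forall>v\<in>A. u \<noteq> v \<longrightarrow>
           (\<exists>\<gamma>. joins_in S u v \<gamma> \<and> strictly_convex_on {0..1} (\<lambda>t. I (\<gamma> t))))
         \<longrightarrow> (\<forall>u\<in>A. \<forall>v\<in>A. u = v))"
proof -
  have min: "I u \<le> I (\<gamma> t)"
    if "u \<in> A" "joins_in S u v \<gamma>" "convex_on {0..1} (\<lambda>t. I (\<gamma> t))" "t \<in> {0..1}" for u v \<gamma> t
    using critical_point_min_along_convex_path[of I R u v \<gamma> t] assms(4,6) that by simp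
  have le: "I u \<le> I v" if "u \<in> A" "v \<in> A" for u v
  proof -
    obtain \<gamma> where \<gamma>: "joins_in S u v \<gamma>" "convex_on {0..1} (\<lambda>t. I (\<gamma> t))"
      using assms(7) \<open>u \<in> A\<close> \<open>v \<in> A\<close> by blast
    then show ?thesis
      using min[of u v \<gamma> 1] \<open>u \<in> A\<close> by (simp add: joins_in_def)
  qed
  \<comment> \<open>\<open>le\<close> is used in both directions. The second use takes a path chosen
    for the pair \<open>v\<close>, \<open>u\<close>, not the reversed first path, which may fail to
    be Lipschitz at its new start.\<close>
  have eq: "I u = I v" if "u \<in> A" "v \<in> A" for u v
    using le that by (simp add: antisym)
  have const: "I (\<gamma> t) = I u"
    if "u \<in> A" "v \<in> A" "joins_in S u v \<gamma>" "convex_on {0..1} (\<lambda>t. I (\<gamma> t))" "t \<in> {0..1}"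
    for u v \<gamma> t
  proof (rule antisym)
    \<comment> \<open>The chord over the whole interval is horizontal, since \<open>I\<close> agrees
      at the two endpoints of the path.\<close>
    have "I (\<gamma> t) \<le> (1 - t) * I (\<gamma> 0) + t * I (\<gamma> 1)"
      using convex_onD[OF that(4), of t 0 1] that(5) by simp
    also have "\<dots> = I u"
      using that(3) eq[OF that(1,2)] by (simp add: joins_in_def algebra_simps)
    finally show "I (\<gamma> t) \<le> I u" .
  qed (use min that in blast)
  show ?thesis
  proof (intro conjI ballI allI impI)
    show "I constant_on A"
      unfolding constant_on_def using eq by blast
  next
    fix u v \<gamma>
    assume "u \<in> A" "v \<in> A" "joins_in S u v \<gamma> \<and> convex_on {0..1} (\<lambda>t. I (\<gamma> t))"
    then show "(\<lambda>t. I (\<gamma> t)) constant_on {0..1}"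
      unfolding constant_on_def using const by blast
  next
    fix u v
    assume ex: "\<forall>u\<in>A. \<forall>v\<in>A. u \<noteq> v \<longrightarrow>
        (\<exists>\<gamma>. joins_in S u v \<gamma> \<and> strictly_convex_on {0..1} (\<lambda>t. I (\<gamma> t)))"
      and uv: "u \<in> A" "v \<in> A"
    show "u = v"
    proof (rule ccontr)
      assume "u \<noteq> v"
      then obtain \<gamma> where \<gamma>: "joins_in S u v \<gamma>" "strictly_convex_on {0..1} (\<lambda>t. I (\<gamma> t))"
        using ex uv by blast
      have c: "I (\<gamma> t) = I u" if "t \<in> {0..1}" for t
        using const[OF uv \<gamma>(1) strictly_convex_on_imp_convex_on[OF \<gamma>(2)] that] .
      \<comment> \<open>Strict convexity at the midpoint puts \<open>I u\<close> strictly below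
        itself, since \<open>I\<close> is constant along the path by \<open>c\<close>.\<close>
      have "I (\<gamma> ((1/2) *\<^sub>R 0 + (1/2) *\<^sub>R 1)) < 1/2 * I (\<gamma> 0) + 1/2 * I (\<gamma> 1)"
        by (rule strictly_convex_onD[OF \<gamma>(2)]) auto
      then show False
        using c[of "1/2"] c[of 0] c[of 1] by simp
    qed
  qed
qed

end
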